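(* If $a$ and $b$ are relatively prime integers, then $(3,1)$ is the only choice of $(a,b)$ for which every positive integer $n$ is an $(a,b)$ balancing number.
   Context: For coprime positive integers $a,b$, the $(a,b)$ balancing numbers are the positive integers $n$ such that the equality $$a\left(1+2+\cdots+(n-1)\right)=b\left((n+1)+(n+2)+\cdots+(n+r)\right)$$ is satisfied for some positive integer $r$; this $r$ is called the balancer of $n$.
   Formalization: "Every positive integer n" is replaced by "every integer n > 1": with a positive balancer r, n = 1 gives 0 on the left and a positive number on the right, so 1 is never an (a,b) balancing number, even for (3,1). *)

theory Defs
  imports Main
begin

definition balancer :: "nat \<Rightarrow> nat \<Rightarrow> nat \<Rightarrow> nat \<Rightarrow> bool" where
  "balancer a b n r \<longleftrightarrow> r > 0 \<and> a * (\<Sum>i = 1..<n. i) = b * (\<Sum>i = n + 1..n + r. i)"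

definition balancing_number :: "nat \<Rightarrow> nat \<Rightarrow> nat \<Rightarrow> bool" where
  "balancing_number a b n \<longleftrightarrow> n > 0 \<and> (\<exists>r. balancer a b n r)"

text \<open>
  Since balancers are required to be positive, 1 is never a balancing number: the left-hand
  sum is empty, so only the degenerate value r = 0 balances. A claim that every positive
  integer is a balancing number therefore has to be read as ranging over n greater than 1.
  Admitting r = 0 instead would amount to the same: n = 1 then holds for all a and b, while
  for n greater than 1 and a, b positive, r = 0 is impossible.
\<close>

lemma not_balancing_number_1:
  assumes "b > 0"
  shows "\<not> balancing_number a b 1"
proof
  assume "balancing_number a b 1"
  then obtain r where r: "r > 0" "a * (\<Sum>i = 1..<1. i) = b * (\<Sum>i = 1 + 1..1 + r. i)"
    unfolding balancing_number_def balancer_def by blast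
  have "b * (\<Sum>i = 1 + 1..1 + r. i) = 0"
    unfolding r(2)[symmetric] by simp
  then have "(\<Sum>i = 1 + 1..1 + r. i) = 0"
    using assms by (metis mult_is_0 less_irrefl)
  moreover have "1 + 1 \<in> {1 + 1..1 + r}"
    using r(1) by simp
  ultimately have "1 + 1 = (0::nat)"
    using sum_eq_0_iff[of "{1 + 1..1 + r}" "\<lambda>i. i"] by blast
  then show False by simp
qed

end

(* Completing the square, n is an (a,b) balancing number only if (2n+1)^2 + 2 c n (n-1) is a
   square, where c = 2a/b; the case n = 2 shows that c is an integer. This is a quadratic
   polynomial in n, and it takes only square values only if its discriminant 4 c (c - 6)
   vanishes, so c = 6 and a = 3b. For the converse, r = n - 1 is a balancer of n for (3,1). *)

theory Submission
  imports Defs "HOL-Computational_Algebra.Primes"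
begin

text \<open>If the discriminant d is nonzero, then at a multiple n of d the value of the polynomial is 1
  modulo d. A prime p dividing that value does not divide d, so the polynomial has a simple root
  modulo p, and its values at n and n + p cannot both be divisible by the square of p.\<close>

lemma square_valued_quadratic_discriminant:
  fixes A B :: int
  assumes "A > 0"
    and square: "\<And>n. n > 1 \<Longrightarrow> \<exists>m. A * n\<^sup>2 + B * n + 1 = m\<^sup>2"
  shows "B\<^sup>2 = 4 * A"
proof (rule ccontr)
  define d where "d = B\<^sup>2 - 4 * A"
  \<comment> \<open>The factor \<open>2 + \<bar>B\<bar>\<close> forces \<open>A * n + B > 0\<close>,
    so the value at \<open>n\<close> exceeds 1 and has a prime divisor.\<close>
  define n where "n = (2 + \<bar>B\<bar>) * \<bar>d\<bar>"
  assume "B\<^sup>2 \<noteq> 4 * A"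
  then have "\<bar>d\<bar> \<ge> 1" by (simp add: d_def)
  then have n: "n \<ge> 2 + \<bar>B\<bar>"
    unfolding n_def using mult_left_mono[of 1 "\<bar>d\<bar>" "2 + \<bar>B\<bar>"] by simp
  then have "n > 1" by linarith
  then obtain m where m: "A * n\<^sup>2 + B * n + 1 = m\<^sup>2" using square[of n] by blast
  have "A * n \<ge> n" using \<open>A > 0\<close> \<open>n > 1\<close> by simp
  then have "n * (A * n + B) > 0" using n \<open>n > 1\<close> by (intro mult_pos_pos) linarith+
  then have "m\<^sup>2 > 1" using m by (simp add: algebra_simps power2_eq_square)
  then have "m \<noteq> 0" "\<not> is_unit m" by (auto simp: abs_if split: if_splits)
  then obtain p where p: "prime p" "p dvd m" using prime_divisor_exists by blast
  have "p > 1" using p(1) by (rule prime_gt_1_int)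
  have pp: "p\<^sup>2 dvd m\<^sup>2" using p(2) by (rule dvd_power_same)
  obtain l where l: "A * (n + p)\<^sup>2 + B * (n + p) + 1 = l\<^sup>2"
    using square[of "n + p"] \<open>n > 1\<close> \<open>p > 1\<close> by auto
  \<comment> \<open>Taylor expansion at \<open>n\<close>: modulo \<open>p\<^sup>2\<close> the two
    values differ only by \<open>p\<close> times the derivative
    \<open>2 * A * n + B\<close>.\<close>
  have l': "l\<^sup>2 = m\<^sup>2 + p * (2 * A * n + B) + A * p\<^sup>2"
    unfolding l[symmetric] m[symmetric] by (simp add: algebra_simps power2_eq_square)
  have "p dvd l\<^sup>2" unfolding l' using p(2) by (simp add: power2_eq_square)
  then have "p dvd l" using p(1) prime_dvd_power by blast
  then have "p\<^sup>2 dvd l\<^sup>2" by (rule dvd_power_same)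
  then have "p\<^sup>2 dvd l\<^sup>2 - m\<^sup>2 - A * p\<^sup>2" using pp by simp
  also have "l\<^sup>2 - m\<^sup>2 - A * p\<^sup>2 = p * (2 * A * n + B)" using l' by simp
  finally have "p dvd 2 * A * n + B" using \<open>p > 1\<close> by (simp add: power2_eq_square)
  \<comment> \<open>The discriminant is the square of the derivative minus \<open>4 * A\<close>
    times the value.\<close>
  then have "p dvd (2 * A * n + B)\<^sup>2 - 4 * A * m\<^sup>2" using p(2) by (simp add: power2_eq_square)
  also have "(2 * A * n + B)\<^sup>2 - 4 * A * m\<^sup>2 = d"
    unfolding m[symmetric] d_def by (simp add: algebra_simps power2_eq_square)
  finally have "p dvd n" by (simp add: n_def)
  then have "p dvd m\<^sup>2 - (A * n + B) * n" using p(2) by (simp add: power2_eq_square)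
  also have "m\<^sup>2 - (A * n + B) * n = 1"
    unfolding m[symmetric] by (simp add: algebra_simps power2_eq_square)
  finally show False using p(1) by (simp add: prime_int_iff)
qed

text \<open>Gauss summation on both sides, doubled to avoid division. The truncated
  \<open>n - 1\<close> is harmless at \<open>n = 0\<close>, where the factor \<open>n\<close>
  vanishes.\<close>

lemma balancer_iff:
  "balancer a b n r \<longleftrightarrow> r > 0 \<and> a * (n * (n - 1)) = b * (r * (2 * n + r + 1))"
proof -
  have "2 * (\<Sum>i = 1..<n. i) = n * (n - 1)"
  proof (induction n)
    case (Suc n)
    then show ?case by (cases n) (simp_all add: algebra_simps)
  qed simp
  then have left: "n * (n - 1) = 2 * (\<Sum>i = 1..<n. i)" by (rule sym)
  have "2 * (\<Sum>i = n + 1..n + r. i) = r * (2 * n + r + 1)"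
    by (induction r) (auto simp: algebra_simps)
  then have right: "r * (2 * n + r + 1) = 2 * (\<Sum>i = n + 1..n + r. i)" by (rule sym)
  show ?thesis unfolding balancer_def left right by auto
qed

theorem theorem1p9:
  fixes a b :: nat
  assumes "a > 0" and "b > 0" and "coprime a b"
  shows "(\<forall>n > 1. balancing_number a b n) \<longleftrightarrow> (a, b) = (3, 1)"
proof
  assume "(a, b) = (3, 1)"
  \<comment> \<open>With \<open>r = n - 1\<close> the factor \<open>2 * n + r + 1\<close> is
    \<open>3 * n\<close>.\<close>
  moreover have "balancer 3 1 n (n - 1)" if "n > 1" for n
    using that by (cases n) (auto simp: balancer_iff algebra_simps)
  ultimately show "\<forall>n > 1. balancing_number a b n"
    by (auto simp: balancing_number_def)
next
  assume all: "\<forall>n > 1. balancing_number a b n"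
  have ex: "\<exists>r. a * (n * (n - 1)) = b * (r * (2 * n + r + 1))" if "n > 1" for n
    using all that by (auto simp: balancing_number_def balancer_iff)
  obtain c where c: "a * 2 = b * c" using ex[of 2] by auto
  then have "c > 0" using assms(1) by (cases c) auto
  \<comment> \<open>The coefficients come from expanding
    \<open>(2 * n + 1)\<^sup>2 + 2 * c * n * (n - 1)\<close>.\<close>
  have "(4 - 2 * int c)\<^sup>2 = 4 * (4 + 2 * int c)"
  proof (rule square_valued_quadratic_discriminant)
    fix n :: int
    assume "n > 1"
    define k where "k = nat n"
    have k: "n = int k" "k > 1" using \<open>n > 1\<close> by (auto simp: k_def)
    obtain r where r: "a * (k * (k - 1)) = b * (r * (2 * k + r + 1))" using ex k(2) by blast
    have "b * (c * (k * (k - 1))) = 2 * (a * (k * (k - 1)))"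
      unfolding mult.assoc[symmetric] c[symmetric] by (simp only: mult.commute)
    also have "\<dots> = b * (2 * (r * (2 * k + r + 1)))"
      unfolding r by (rule mult.left_commute)
    finally have "b * (c * (k * (k - 1))) = b * (2 * (r * (2 * k + r + 1)))" .
    then have "c * (k * (k - 1)) = 2 * (r * (2 * k + r + 1))" using assms(2) by simp
    then have "int (c * (k * (k - 1))) = int (2 * (r * (2 * k + r + 1)))" by (rule arg_cong)
    then have "int c * (n * (n - 1)) = 2 * (int r * (2 * n + int r + 1))"
      using k by (simp add: algebra_simps)
    \<comment> \<open>Double the equation and add \<open>(2 * n + 1)\<^sup>2\<close> to both
      sides.\<close>
    then have "(4 + 2 * int c) * n\<^sup>2 + (4 - 2 * int c) * n + 1 = (2 * int r + 2 * n + 1)\<^sup>2"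
      by (simp add: algebra_simps power2_eq_square)
    then show "\<exists>m. (4 + 2 * int c) * n\<^sup>2 + (4 - 2 * int c) * n + 1 = m\<^sup>2" ..
  qed simp
  then have "int c * (int c - 6) = 0" by (simp add: algebra_simps power2_eq_square)
  then have "a = 3 * b" using c \<open>c > 0\<close> by simp
  \<comment> \<open>Now \<open>b\<close> divides \<open>a\<close>, so coprimality forces
    \<open>b = 1\<close>.\<close>
  then show "(a, b) = (3, 1)" using assms(3) by simp
qed

end
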